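(* Let $\mathcal S$ be a union-closed set system on $\Omega$. If $\mathcal S$ has infinite breadth, then there is a spread $\mathcal E=(E_n)_{n\in\mathbb N}$ in $\Omega$ such that at least one of the following statements holds: (i) $\{\mathsf x\cap\operatorname{join}(\mathcal E):\mathsf x\in\mathcal S\}\supseteq\mathcal T_{\rm max}(\mathcal E)$; (ii) $\{\mathsf x\cap\operatorname{join}(\mathcal E):\mathsf x\in\mathcal S\}\supseteq\mathcal T_{\rm min}(\mathcal E)$; (iii) $\{\mathsf x\cap\operatorname{join}(\mathcal E):\mathsf x\in\mathcal S\}\supseteq\mathcal T_{\rm ort}(\mathcal E)$ and there is an $\mathcal S$-decisive colouring of $\mathcal E$.
   Context: $\Omega$ is a non-empty set and $\mathcal P(\Omega)$ its power set; $\mathsf x^c=\Omega\setminus\mathsf x$. A union-closed set system on $\Omega$ is a subset $\mathcal S\subseteq\mathcal P(\Omega)$ closed under finite (i.e. binary) unions. For a finite non-empty $\mathcal F\subseteq\mathcal S$ put $\operatorname{join}(\mathcal F)=\bigcup_{\mathsf x\in\mathcal F}\mathsf x$; $\mathcal F$ is compressible if there is a proper subset $\mathcal F'\subset\mathcal F$ with $\operatorname{join}(\mathcal F')=\operatorname{join}(\mathcal F)$, and incompressible otherwise. The breadth of $\mathcal S$ is $\sup\{n\in\mathbb N:\mathcal S\text{ has an incompressible subset with }n\text{ elements}\}$; it is infinite if there are incompressible subsets of arbitrarily large finite size. A spread in $\Omega$ is a sequence $\mathcal E=(E_n)_{n\ge1}$ of finite non-empty, pairwise disjoint subsets of $\Omega$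 with $|E_n|\to\infty$. Write $\operatorname{join}(\mathcal E)=\bigcup_{n\ge1}E_n$, $E_{<n}=E_1\cup\dots\cup E_{n-1}$ (with $E_{<1}=\emptyset$), $E_{>n}=\bigcup_{j\ge n+1}E_j$. Define the set systems $\mathcal T_{\rm max}(\mathcal E)=\{E_{<n}\cup\mathsf a: n\ge1,\ \emptyset\ne\mathsf a\subseteq E_n\}$, $\mathcal T_{\rm min}(\mathcal E)=\{\mathsf a\cup E_{>n}: n\ge1,\ \emptyset\ne\mathsf a\subseteq E_n\}$, $\mathcal T_{\rm ort}(\mathcal E)=\{E_{<n}\cup\mathsf a\cup E_{>n}: n\ge1,\ \emptyset\ne\mathsf a\subseteq E_n\}$. A colouring of $\mathcal E$ is a partition $\mathcal C=\{C_0,\dots,C_d\}$ of $\Omega$ into finitely many disjoint subsets such that $\lim_n|C_j\cap E_n|=\infty$ for each $j$. It is $\mathcal S$-decisive (with respect to $\mathcal E$) if there exists $C_0\in\mathcal C$ such that every $\mathsf x\in\mathcal S$ satisfies $$\sup_{n\ge1}\ \min\Big(\{|\mathsf x\cap C_0\cap E_n|\}\cup\{|\mathsf x^c\cap C\cap E_n|: C\in\mathcal C\}\Big)<\infty .$$ *)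

theory Defs
  imports Main "HOL-Library.Extended_Nat" "HOL-Library.Disjoint_Sets"
begin

definition union_closed_on :: "'a set \<Rightarrow> 'a set set \<Rightarrow> bool" where
  "union_closed_on \<Omega> S \<longleftrightarrow> S \<subseteq> Pow \<Omega> \<and> (\<forall>x\<in>S. \<forall>y\<in>S. x \<union> y \<in> S)"

text \<open>The subfamily \<open>F'\<close> may be empty, with join \<open>{}\<close>. This matters only for
  \<open>F = {{}}\<close>, hence not for whether the breadth is infinite.\<close>

definition compressible :: "'a set set \<Rightarrow> bool" where
  "compressible F \<longleftrightarrow> (\<exists>F'. F' \<subset> F \<and> \<Union>F' = \<Union>F)"

definition breadth :: "'a set set \<Rightarrow> enat" where
  "breadth S = Sup {enat (card F) | F. F \<subseteq> S \<and> finite F \<and> F \<noteq> {} \<and> \<not> compressible F}"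

text \<open>Spreads are indexed from \<open>0\<close> instead of \<open>1\<close>.\<close>

definition spread :: "'a set \<Rightarrow> (nat \<Rightarrow> 'a set) \<Rightarrow> bool" where
  "spread \<Omega> E \<longleftrightarrow>
     (\<forall>n. finite (E n) \<and> E n \<noteq> {} \<and> E n \<subseteq> \<Omega>) \<and> disjoint_family E \<and>
     filterlim (\<lambda>n. card (E n)) at_top sequentially"

definition spread_join :: "(nat \<Rightarrow> 'a set) \<Rightarrow> 'a set" where
  "spread_join E = (\<Union>n. E n)"

definition spread_below :: "(nat \<Rightarrow> 'a set) \<Rightarrow> nat \<Rightarrow> 'a set" where
  "spread_below E n = (\<Union>j\<in>{..<n}. E j)"

definition spread_above :: "(nat \<Rightarrow> 'a set) \<Rightarrow> nat \<Rightarrow> 'a set" where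
  "spread_above E n = (\<Union>j\<in>{n<..}. E j)"

definition T_max :: "(nat \<Rightarrow> 'a set) \<Rightarrow> 'a set set" where
  "T_max E = {spread_below E n \<union> a | n a. a \<noteq> {} \<and> a \<subseteq> E n}"

definition T_min :: "(nat \<Rightarrow> 'a set) \<Rightarrow> 'a set set" where
  "T_min E = {a \<union> spread_above E n | n a. a \<noteq> {} \<and> a \<subseteq> E n}"

definition T_ort :: "(nat \<Rightarrow> 'a set) \<Rightarrow> 'a set set" where
  "T_ort E = {spread_below E n \<union> a \<union> spread_above E n | n a. a \<noteq> {} \<and> a \<subseteq> E n}"

definition colouring :: "'a set \<Rightarrow> (nat \<Rightarrow> 'a set) \<Rightarrow> 'a set set \<Rightarrow> bool" where
  "colouring \<Omega> E \<C> \<longleftrightarrow>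
     finite \<C> \<and> partition_on \<Omega> \<C> \<and>
     (\<forall>C\<in>\<C>. filterlim (\<lambda>n. card (C \<inter> E n)) at_top sequentially)"

definition decisive :: "'a set \<Rightarrow> 'a set set \<Rightarrow> (nat \<Rightarrow> 'a set) \<Rightarrow> 'a set set \<Rightarrow> bool" where
  "decisive \<Omega> S E \<C> \<longleftrightarrow>
     (\<exists>C0\<in>\<C>. \<forall>x\<in>S.
        (SUP n. enat (Min ({card (x \<inter> C0 \<inter> E n)} \<union> {card ((\<Omega> - x) \<inter> C \<inter> E n) | C. C \<in> \<C>}))) < \<infinity>)"

end

(*
  Call a finite set F of pairs (point, member of S) free if each member contains, among the
  points of F, only its own.  Infinite breadth gives free sets of every size, and "containing
  free sets of every size" is partition regular.  Hence one can pick successive free blocks such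
  that whether a member of one block contains a point of another depends only on which block
  comes first.  If members miss all later points, unions of members yield T_max.  If they contain
  all later points, they yield T_min or T_ort, according to whether they miss or contain the
  earlier ones.

  In the last case, suppose that no spread obtained by shrinking and thinning out the blocks has
  a decisive colouring.  Given y_0, ..., y_(N-1) in S that are disjoint on such a spread, colour
  it by these sets and the remainder C_0.  Indecisiveness gives y_N in S with large trace on C_0
  and large complement in every colour; discarding the overlap of y_N with the earlier sets
  restores disjointness.  So for all N there are points lying in exactly one of y_0, ..., y_(N-1),
  and choosing them in consecutive blocks of indices produces T_max.
*)
theory Submission
  imports Defs "HOL-Library.Infinite_Set"
begin

section \<open>Traces on the join of a spread, and witnesses producing the three set systems\<close>

definition traces :: "'a set set \<Rightarrow> 'a set \<Rightarrow> 'a set set" where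
  "traces S J = {x \<inter> J | x. x \<in> S}"

lemma traces_Union:
  assumes "union_closed_on \<Omega> S" "finite F" "F \<noteq> {}" "F \<subseteq> traces S J"
  shows "\<Union>F \<in> traces S J"
  using assms(2-4)
proof (induction F rule: finite_ne_induct)
  case (singleton t)
  then show ?case by simp
next
  case (insert t F)
  then obtain x y where "x \<in> S" "t = x \<inter> J" "y \<in> S" "\<Union>F = y \<inter> J"
    by (auto simp: traces_def)
  then have "x \<union> y \<in> S" "\<Union>(insert t F) = (x \<union> y) \<inter> J"
    using assms(1) by (auto simp: union_closed_on_def)
  then show ?case unfolding traces_def by blast
qed

text \<open>This is how members with an infinite part are reached by finite unions: every witness
  already contains all of \<open>H\<close>, and the union only varies the finite part
  \<open>a\<close>. Since \<open>a\<close> is non-empty, \<open>H\<close> is really covered.\<close>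

lemma traces_extend:
  assumes "union_closed_on \<Omega> S" "finite a" "a \<noteq> {}" "\<And>\<gamma>. \<gamma> \<in> a \<Longrightarrow> H \<union> {\<gamma>} \<in> traces S J"
  shows "H \<union> a \<in> traces S J"
proof -
  have "\<Union>((\<lambda>\<gamma>. H \<union> {\<gamma>}) ` a) \<in> traces S J"
    using assms by (intro traces_Union) auto
  moreover have "\<Union>((\<lambda>\<gamma>. H \<union> {\<gamma>}) ` a) = H \<union> a"
    using assms(3) by auto
  ultimately show ?thesis by simp
qed

lemma spread_join_split: "spread_join E = spread_below E n \<union> E n \<union> spread_above E n"
proof -
  have "(UNIV :: nat set) = {..<n} \<union> {n} \<union> {n<..}"
    by auto
  then show ?thesis
    unfolding spread_join_def spread_below_def spread_above_def
    by (metis UN_Un UN_insert UN_empty Un_empty_right)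
qed

text \<open>The single bound \<open>n < card (E n)\<close> yields both non-emptiness and divergence
  of the sizes, so all spreads below are built with it.\<close>

lemma spreadI:
  assumes "\<And>n. finite (E n)" "\<And>n. E n \<subseteq> \<Omega>" "\<And>n. n < card (E n)"
    and "\<And>m n. m < n \<Longrightarrow> E m \<inter> E n = {}"
  shows "spread \<Omega> E"
  unfolding spread_def disjoint_family_on_def
proof (intro conjI allI ballI impI)
  fix n show "E n \<noteq> {}"
    using assms(3)[of n] by auto
next
  fix m n :: nat assume "m \<noteq> n"
  then show "E m \<inter> E n = {}"
    using assms(4)[of m n] assms(4)[of n m] by (cases m n rule: linorder_cases) auto
next
  show "filterlim (\<lambda>n. card (E n)) at_top sequentially"
    by (rule filterlim_at_top_mono[OF filterlim_ident]) (simp add: assms(3) less_imp_le)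
qed (use assms in auto)

text \<open>A witness may meet earlier blocks in any way. This is harmless: a member of
  \<open>T_max E\<close> is a finite set containing all blocks before its last one, so it is the
  union of the witness traces of all its points, and none of these traces leaves it.\<close>

lemma T_max_subset_traces:
  assumes "union_closed_on \<Omega> S" "\<And>n. finite (E n)"
    and wit: "\<And>n \<gamma>. \<gamma> \<in> E n \<Longrightarrow> \<exists>x\<in>S. x \<inter> E n = {\<gamma>} \<and> (\<forall>m>n. x \<inter> E m = {})"
  shows "T_max E \<subseteq> traces S (spread_join E)"
proof -
  have key: "\<exists>t\<in>traces S (spread_join E). \<gamma> \<in> t \<and> t \<subseteq> spread_below E n \<union> {\<gamma>}"
    if \<gamma>: "\<gamma> \<in> E n" for n \<gamma>
  proof -
    obtain x where x: "x \<in> S" "x \<inter> E n = {\<gamma>}" "\<forall>m>n. x \<inter> E m = {}"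
      using wit[OF \<gamma>] by blast
    then have "x \<inter> spread_above E n = {}"
      by (auto simp: spread_above_def)
    then have "\<gamma> \<in> x \<inter> spread_join E" "x \<inter> spread_join E \<subseteq> spread_below E n \<union> {\<gamma>}"
      using x(2) by (auto simp: spread_join_split[of E n])
    with x(1) show ?thesis by (auto simp: traces_def)
  qed
  have "spread_below E n \<union> a \<in> traces S (spread_join E)"
    if a: "a \<noteq> {}" "a \<subseteq> E n" for n a
  proof -
    let ?D = "spread_below E n \<union> a"
    have "\<forall>\<gamma>\<in>?D. \<exists>t\<in>traces S (spread_join E). \<gamma> \<in> t \<and> t \<subseteq> ?D"
    proof
      fix \<gamma> assume "\<gamma> \<in> ?D"
      then consider m where "m < n" "\<gamma> \<in> E m" | "\<gamma> \<in> a"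
        by (auto simp: spread_below_def)
      then show "\<exists>t\<in>traces S (spread_join E). \<gamma> \<in> t \<and> t \<subseteq> ?D"
      proof cases
        case 1
        then have "spread_below E m \<union> {\<gamma>} \<subseteq> ?D"
          by (auto simp: spread_below_def intro: less_trans)
        then show ?thesis using key[OF 1(2)] by blast
      next
        case 2
        then show ?thesis using key[of \<gamma> n] a by blast
      qed
    qed
    then obtain t where t: "\<forall>\<gamma>\<in>?D. t \<gamma> \<in> traces S (spread_join E) \<and> \<gamma> \<in> t \<gamma> \<and> t \<gamma> \<subseteq> ?D"
      by metis
    have "finite ?D"
      using assms(2) a finite_subset by (auto simp: spread_below_def)
    then have "\<Union>(t ` ?D) \<in> traces S (spread_join E)"
      using a t by (intro traces_Union[OF assms(1)]) auto
    moreover have "\<Union>(t ` ?D) = ?D"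
      using t by blast
    ultimately show ?thesis by simp
  qed
  then show ?thesis by (auto simp: T_max_def)
qed

lemma T_min_subset_traces:
  assumes "union_closed_on \<Omega> S" "\<And>n. finite (E n)"
    and wit: "\<And>n \<gamma>. \<gamma> \<in> E n \<Longrightarrow> \<exists>x\<in>S. x \<inter> E n = {\<gamma>} \<and> (\<forall>m>n. E m \<subseteq> x) \<and> (\<forall>m<n. x \<inter> E m = {})"
  shows "T_min E \<subseteq> traces S (spread_join E)"
proof -
  have "a \<union> spread_above E n \<in> traces S (spread_join E)"
    if a: "a \<noteq> {}" "a \<subseteq> E n" for n a
  proof -
    have "spread_above E n \<union> a \<in> traces S (spread_join E)"
    proof (rule traces_extend[OF assms(1)])
      fix \<gamma> assume "\<gamma> \<in> a"
      then obtain x where x: "x \<in> S" "x \<inter> E n = {\<gamma>}" "\<forall>m>n. E m \<subseteq> x" "\<forall>m<n. x \<inter> E m = {}"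
        using wit[of \<gamma> n] a by blast
      then have "x \<inter> spread_below E n = {}" "spread_above E n \<subseteq> x"
        by (auto simp: spread_above_def spread_below_def)
      then have "x \<inter> spread_join E = spread_above E n \<union> {\<gamma>}"
        using x(2) by (auto simp: spread_join_split[of E n])
      with x(1) show "spread_above E n \<union> {\<gamma>} \<in> traces S (spread_join E)"
        unfolding traces_def by blast
    qed (use a assms(2) finite_subset in auto)
    then show ?thesis by (simp add: Un_commute)
  qed
  then show ?thesis by (auto simp: T_min_def)
qed

lemma T_ort_subset_traces:
  assumes "union_closed_on \<Omega> S" "\<And>n. finite (E n)"
    and wit: "\<And>n \<gamma>. \<gamma> \<in> E n \<Longrightarrow> \<exists>x\<in>S. x \<inter> E n = {\<gamma>} \<and> (\<forall>m. m \<noteq> n \<longrightarrow> E m \<subseteq> x)"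
  shows "T_ort E \<subseteq> traces S (spread_join E)"
proof -
  have "spread_below E n \<union> a \<union> spread_above E n \<in> traces S (spread_join E)"
    if a: "a \<noteq> {}" "a \<subseteq> E n" for n a
  proof -
    let ?H = "spread_below E n \<union> spread_above E n"
    have "?H \<union> a \<in> traces S (spread_join E)"
    proof (rule traces_extend[OF assms(1)])
      fix \<gamma> assume "\<gamma> \<in> a"
      then obtain x where x: "x \<in> S" "x \<inter> E n = {\<gamma>}" "\<forall>m. m \<noteq> n \<longrightarrow> E m \<subseteq> x"
        using wit[of \<gamma> n] a by blast
      then have "?H \<subseteq> x"
        by (auto simp: spread_above_def spread_below_def)
      then have "x \<inter> spread_join E = ?H \<union> {\<gamma>}"
        using x(2) by (auto simp: spread_join_split[of E n])
      with x(1) show "?H \<union> {\<gamma>} \<in> traces S (spread_join E)"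
        unfolding traces_def by blast
    qed (use a assms(2) finite_subset in auto)
    then show ?thesis by (simp add: Un_ac)
  qed
  then show ?thesis by (auto simp: T_ort_def)
qed

section \<open>Free sets of pairs, partition regularity, and homogeneous sequences of blocks\<close>

definition free :: "('a \<times> 'a set) set \<Rightarrow> bool" where
  "free F \<longleftrightarrow> (\<forall>p\<in>F. \<forall>q\<in>F. fst q \<in> snd p \<longleftrightarrow> p = q)"

text \<open>Finite free subsets of every size are asked for, not an infinite one: that much infinite
  breadth supplies, and it survives splitting into two classes.\<close>

definition big :: "('a \<times> 'a set) set \<Rightarrow> bool" where
  "big B \<longleftrightarrow> (\<forall>k. \<exists>F\<subseteq>B. finite F \<and> card F = k \<and> free F)"

lemma free_subset: "free F \<Longrightarrow> G \<subseteq> F \<Longrightarrow> free G"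
  unfolding free_def by blast

lemma card_split_half:
  fixes Q :: "'b \<Rightarrow> bool"
  assumes "finite F" "2 * k \<le> card F"
  shows "\<exists>b. k \<le> card {p \<in> F. Q p = b}"
proof -
  have "F = {p \<in> F. Q p = True} \<union> {p \<in> F. Q p = False}"
    by auto
  then have "card F \<le> card {p \<in> F. Q p = True} + card {p \<in> F. Q p = False}"
    by (metis card_Un_le)
  with assms(2) have "k \<le> card {p \<in> F. Q p = True} \<or> k \<le> card {p \<in> F. Q p = False}"
    by linarith
  then show ?thesis by blast
qed

text \<open>If both classes failed, each would omit free sets of some size. A free set of twice the
  larger of these sizes has at least half of its elements in one class, and subsets of free sets are
  free.\<close>

lemma big_split:
  fixes Q :: "'a \<times> 'a set \<Rightarrow> bool"
  assumes "big B"
  shows "\<exists>b. big {p \<in> B. Q p = b}"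
proof (rule ccontr)
  assume "\<not> ?thesis"
  then have "\<not> big {p \<in> B. Q p = b}" for b by blast
  then have "\<exists>k. \<forall>F. F \<subseteq> {p \<in> B. Q p = b} \<longrightarrow> finite F \<longrightarrow> free F \<longrightarrow> card F \<noteq> k" for b
    unfolding big_def by meson
  then have "\<exists>k. \<forall>b F. F \<subseteq> {p \<in> B. Q p = b} \<longrightarrow> finite F \<longrightarrow> free F \<longrightarrow> card F \<noteq> k b"
    by (intro choice allI)
  then obtain k where k: "\<forall>b F. F \<subseteq> {p \<in> B. Q p = b} \<longrightarrow> finite F \<longrightarrow> free F \<longrightarrow> card F \<noteq> k b" ..
  define K where "K = max (k True) (k False)"
  obtain F where F: "F \<subseteq> B" "finite F" "card F = 2 * K" "free F"
    using assms unfolding big_def by blast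
  then obtain b where "K \<le> card {p \<in> F. Q p = b}"
    using card_split_half[of F K Q] by auto
  then have "k b \<le> card {p \<in> F. Q p = b}"
    by (cases b) (auto simp: K_def)
  then obtain G where G: "G \<subseteq> {p \<in> F. Q p = b}" "card G = k b" "finite G"
    by (rule obtain_subset_with_card_n)
  then have "G \<subseteq> {p \<in> B. Q p = b}" "free G"
    using F free_subset[of F G] by auto
  with k[rule_format, of G b] G(2,3) show False by simp
qed

text \<open>Splits once for each \<open>p\<close> in \<open>A\<close>. The constant value
  \<open>b\<close> may still depend on \<open>p\<close>.\<close>

lemma big_split_finite:
  fixes R :: "'b \<Rightarrow> 'a \<times> 'a set \<Rightarrow> bool"
  assumes "finite A" "big B"
  shows "\<exists>B'\<subseteq>B. big B' \<and> (\<forall>p\<in>A. \<exists>b. \<forall>q\<in>B'. R p q = b)"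
  using assms(1)
proof induction
  case empty
  then show ?case using assms(2) by auto
next
  case (insert p A)
  then obtain B' where B': "B' \<subseteq> B" "big B'" "\<forall>p\<in>A. \<exists>b. \<forall>q\<in>B'. R p q = b"
    by blast
  obtain b where b: "big {q \<in> B'. R p q = b}"
    using big_split[OF B'(2)] by blast
  have "\<exists>b'. \<forall>q\<in>{q \<in> B'. R p q = b}. R p' q = b'" if p': "p' \<in> insert p A" for p'
  proof (cases "p' = p")
    case True
    then show ?thesis by simp
  next
    case False
    with p' have "p' \<in> A" by simp
    then obtain b' where "\<forall>q\<in>B'. R p' q = b'" using B'(3) by blast
    then show ?thesis by (intro exI[of _ b']) simp
  qed
  moreover have "{q \<in> B'. R p q = b} \<subseteq> B" using B'(1) by auto
  ultimately show ?case using b by (intro exI[of _ "{q \<in> B'. R p q = b}"] conjI ballI)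
qed

text \<open>Start from a free set of size \<open>4 * k\<close>. Thinning the reservoir twice makes
  both membership relations depend only on the element of the free set; halving the free set twice
  then makes them independent of that element too, and \<open>k\<close> elements remain.\<close>

lemma big_step:
  assumes "big B"
  shows "\<exists>F B' e e'. F \<subseteq> B \<and> finite F \<and> card F = k \<and> free F \<and> B' \<subseteq> B \<and> big B' \<and>
    (\<forall>p\<in>F. \<forall>q\<in>B'. (fst q \<in> snd p \<longleftrightarrow> e) \<and> (fst p \<in> snd q \<longleftrightarrow> e'))"
proof -
  obtain F where F: "F \<subseteq> B" "finite F" "card F = 2 * (2 * k)" "free F"
    using assms unfolding big_def by blast
  obtain B1 where B1: "B1 \<subseteq> B" "big B1" "\<forall>p\<in>F. \<exists>b. \<forall>q\<in>B1. (fst q \<in> snd p) = b"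
    using big_split_finite[OF F(2) assms, of "\<lambda>p q. fst q \<in> snd p"] by blast
  obtain B2 where B2: "B2 \<subseteq> B1" "big B2" "\<forall>p\<in>F. \<exists>b. \<forall>q\<in>B2. (fst p \<in> snd q) = b"
    using big_split_finite[OF F(2) B1(2), of "\<lambda>p q. fst p \<in> snd q"] by blast
  obtain c where c: "\<And>p q. p \<in> F \<Longrightarrow> q \<in> B1 \<Longrightarrow> (fst q \<in> snd p) = c p"
    using B1(3) by metis
  obtain c' where c': "\<And>p q. p \<in> F \<Longrightarrow> q \<in> B2 \<Longrightarrow> (fst p \<in> snd q) = c' p"
    using B2(3) by metis
  obtain e where e: "2 * k \<le> card {p \<in> F. c p = e}"
    using card_split_half[of F "2 * k" c] F by auto
  obtain e' where e': "k \<le> card {p \<in> {p \<in> F. c p = e}. c' p = e'}"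
    using card_split_half[OF _ e, of c'] F by auto
  obtain G where G: "G \<subseteq> {p \<in> {p \<in> F. c p = e}. c' p = e'}" "card G = k" "finite G"
    using e' by (rule obtain_subset_with_card_n)
  have "free G" using F(4) G(1) free_subset[of F G] by auto
  moreover have "\<forall>p\<in>G. \<forall>q\<in>B2. (fst q \<in> snd p \<longleftrightarrow> e) \<and> (fst p \<in> snd q \<longleftrightarrow> e')"
    using G(1) c c' B2(1) by blast
  ultimately show ?thesis
    using F(1) G B1 B2 by (intro exI[of _ G] exI[of _ B2] exI[of _ e] exI[of _ e']) auto
qed

text \<open>Iterating \<open>big_step\<close> inside the shrinking reservoirs gives values
  \<open>e\<close>, \<open>e'\<close> that depend only on the earlier of two blocks; passing to
  infinitely many blocks with the same values makes them global. The size \<open>n + 2\<close>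
  guarantees two elements even in block 0, which later forces blocks of points to be
  disjoint.\<close>

lemma big_homogeneous_sequence:
  assumes "big B"
  shows "\<exists>F e e'. (\<forall>n. F n \<subseteq> B \<and> finite (F n) \<and> n + 2 \<le> card (F n) \<and> free (F n)) \<and>
    (\<forall>m n. m < n \<longrightarrow> (\<forall>p\<in>F m. \<forall>q\<in>F n. (fst q \<in> snd p \<longleftrightarrow> e) \<and> (fst p \<in> snd q \<longleftrightarrow> e')))"
proof -
  \<comment> \<open>A state consists of the block \<open>F\<close>, the reservoir \<open>B'\<close>
    for all later blocks, and the two values attached to \<open>F\<close>.\<close>
  define P where "P = (\<lambda>n (F, B', e, e'). F \<subseteq> B \<and> finite F \<and> card F = n + 2 \<and> free F \<and>
    B' \<subseteq> B \<and> big B' \<and> (\<forall>p\<in>F. \<forall>q\<in>B'. (fst q \<in> snd p \<longleftrightarrow> e) \<and> (fst p \<in> snd q \<longleftrightarrow> e')))"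
  define Q where "Q = (\<lambda>(n::nat) (F :: ('a \<times> 'a set) set, B' :: ('a \<times> 'a set) set, e :: bool, e' :: bool)
    (F' :: ('a \<times> 'a set) set, B'' :: ('a \<times> 'a set) set, d :: bool, d' :: bool). F' \<subseteq> B' \<and> B'' \<subseteq> B')"
  have "\<exists>f. \<forall>n. P n (f n) \<and> Q n (f n) (f (Suc n))"
  proof (rule dependent_nat_choice)
    show "\<exists>x. P 0 x"
      using big_step[OF assms, of "0 + 2"] unfolding P_def by auto
  next
    fix x n assume "P n x"
    moreover obtain F B' e e' where "x = (F, B', e, e')"
      by (metis prod_cases4)
    ultimately have "B' \<subseteq> B" "big B'" and x: "x = (F, B', e, e')"
      unfolding P_def by auto
    then obtain G B'' d d' where "G \<subseteq> B' \<and> finite G \<and> card G = Suc n + 2 \<and> free G \<and> B'' \<subseteq> B' \<and> big B'' \<and>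
      (\<forall>p\<in>G. \<forall>q\<in>B''. (fst q \<in> snd p \<longleftrightarrow> d) \<and> (fst p \<in> snd q \<longleftrightarrow> d'))"
      using big_step[of B' "Suc n + 2"] by metis
    then have "P (Suc n) (G, B'', d, d') \<and> Q n x (G, B'', d, d')"
      using \<open>B' \<subseteq> B\<close> unfolding P_def Q_def x by auto
    then show "\<exists>y. P (Suc n) y \<and> Q n x y" by blast
  qed
  then obtain f where f: "\<And>n. P n (f n)" "\<And>n. Q n (f n) (f (Suc n))" by blast
  define F where "F n = fst (f n)" for n
  define C where "C n = fst (snd (f n))" for n
  define c where "c n = snd (snd (f n))" for n
  have F: "F n \<subseteq> B" "finite (F n)" "card (F n) = n + 2" "free (F n)"
    and hom: "\<And>p q. p \<in> F n \<Longrightarrow> q \<in> C n \<Longrightarrow> (fst q \<in> snd p \<longleftrightarrow> fst (c n)) \<and> (fst p \<in> snd q \<longleftrightarrow> snd (c n))" for n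
    using f(1)[of n] unfolding P_def F_def C_def c_def by (auto split: prod.splits)
  have FC: "F (Suc n) \<subseteq> C n" and CC: "C (Suc n) \<subseteq> C n" for n
    using f(2)[of n] unfolding Q_def F_def C_def by (auto split: prod.splits)
  have "C n \<subseteq> C m" if "m \<le> n" for m n
    using CC that lift_Suc_antimono_le[of C] by blast
  then have sub: "F n \<subseteq> C m" if "m < n" for m n
    using FC[of "n - 1"] that by (metis Suc_leI Suc_le_mono Suc_pred' dual_order.trans gr_implies_not0 not_gr_zero)
  \<comment> \<open>There are only four pairs of truth values, so one of them occurs at infinitely
    many stages.\<close>
  have "finite (range c)" by simp
  then obtain ee where inf: "infinite (c -` {ee})"
    using inf_img_fin_dom[of c UNIV] by blast
  define s where "s = enumerate (c -` {ee})"
  have s: "strict_mono s" "c (s n) = ee" for n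
    using strict_mono_enumerate[OF inf] enumerate_in_set[OF inf] by (auto simp: s_def)
  show ?thesis
  proof (intro exI conjI allI impI ballI)
    fix n show "n + 2 \<le> card (F (s n))"
      using F(3) strict_mono_imp_increasing[OF s(1), of n] by simp
  next
    fix m n p q assume "m < n" "p \<in> F (s m)" "q \<in> F (s n)"
    moreover from this have "q \<in> C (s m)"
      using sub[of "s m" "s n"] s(1) by (auto simp: strict_mono_def)
    ultimately show "(fst q \<in> snd p) = fst ee" "(fst p \<in> snd q) = snd ee"
      using hom[of p "s m" q] s(2) by auto
  qed (use F in auto)
qed

text \<open>In an incompressible family, removing a member changes the join, so each member owns a
  point lying in no other one. Pairing members with such points gives a free set.\<close>

lemma big_of_infinite_breadth:
  assumes "S \<subseteq> Pow \<Omega>" "breadth S = \<infinity>"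
  shows "big {p. fst p \<in> \<Omega> \<and> snd p \<in> S}"
  unfolding big_def
proof
  fix k
  have "\<exists>F\<subseteq>S. finite F \<and> \<not> compressible F \<and> k \<le> card F"
  proof (rule ccontr)
    assume "\<not> ?thesis"
    then have "breadth S \<le> enat k"
      unfolding breadth_def by (intro Sup_least) (auto simp: not_le intro: less_imp_le)
    with assms(2) show False by simp
  qed
  then obtain F0 where F0: "F0 \<subseteq> S" "finite F0" "\<not> compressible F0" "k \<le> card F0" by blast
  have "\<forall>x\<in>F0. \<exists>\<gamma>. \<gamma> \<in> x \<and> (\<forall>y\<in>F0. y \<noteq> x \<longrightarrow> \<gamma> \<notin> y)"
  proof
    fix x assume "x \<in> F0"
    then have "F0 - {x} \<subset> F0" by blast
    then have "\<Union>(F0 - {x}) \<noteq> \<Union>F0"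
      using F0(3) exI[of "\<lambda>F'. F' \<subset> F0 \<and> \<Union>F' = \<Union>F0" "F0 - {x}"]
      by (simp only: compressible_def) simp
    then show "\<exists>\<gamma>. \<gamma> \<in> x \<and> (\<forall>y\<in>F0. y \<noteq> x \<longrightarrow> \<gamma> \<notin> y)" by blast
  qed
  then obtain g where "\<forall>x\<in>F0. g x \<in> x \<and> (\<forall>y\<in>F0. y \<noteq> x \<longrightarrow> g x \<notin> y)"
    unfolding bchoice_iff by blast
  then have g: "\<And>x. x \<in> F0 \<Longrightarrow> g x \<in> x" "\<And>x y. x \<in> F0 \<Longrightarrow> y \<in> F0 \<Longrightarrow> y \<noteq> x \<Longrightarrow> g x \<notin> y"
    by blast+
  obtain F1 where F1: "F1 \<subseteq> F0" "card F1 = k" "finite F1"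
    using F0(4) by (rule obtain_subset_with_card_n)
  let ?F = "(\<lambda>x. (g x, x)) ` F1"
  have "card ?F = k"
    using F1 by (subst card_image) (auto simp: inj_on_def)
  moreover have "free ?F"
    using g F1 unfolding free_def by auto
  moreover have "?F \<subseteq> {p. fst p \<in> \<Omega> \<and> snd p \<in> S}"
  proof
    fix p assume "p \<in> ?F"
    then obtain x where "x \<in> F0" "p = (g x, x)" using F1(1) by blast
    then show "p \<in> {p. fst p \<in> \<Omega> \<and> snd p \<in> S}"
      using g(1)[of x] F0(1) assms(1) by auto
  qed
  ultimately show "\<exists>F\<subseteq>{p. fst p \<in> \<Omega> \<and> snd p \<in> S}. finite F \<and> card F = k \<and> free F"
    using F1(3) by blast
qed

section \<open>Unbounded sequences and subspreads\<close>

text \<open>The values up to any index are bounded, so an infinite supremum forces arbitrarily large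
  values beyond that index; these are chosen one after another.\<close>

lemma unbounded_subsequence:
  fixes f :: "nat \<Rightarrow> nat"
  assumes "(SUP n. enat (f n)) = \<infinity>"
  shows "\<exists>s. strict_mono s \<and> (\<forall>n. n < f (s n))"
proof -
  have "\<exists>m>l. k < f m" for k l
  proof (rule ccontr)
    assume "\<not> ?thesis"
    then have *: "f m \<le> k" if "l < m" for m
      using that by (meson not_less)
    have "f m \<le> max k (Max (f ` {..l}))" for m
    proof (cases "l < m")
      case True
      then show ?thesis using * by (simp add: le_max_iff_disj)
    next
      case False
      then have "f m \<le> Max (f ` {..l})" by (intro Max_ge) auto
      then show ?thesis by simp
    qed
    then have "(SUP n. enat (f n)) \<le> enat (max k (Max (f ` {..l})))"
      by (intro SUP_least) (simp only: enat_ord_simps)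
    with assms show False by simp
  qed
  then have "\<exists>s. \<forall>n. n < f (s n) \<and> s n < s (Suc n)"
    by (intro dependent_nat_choice) blast+
  then show ?thesis by (auto simp: strict_mono_Suc_iff)
qed

text \<open>Blocks may be dropped (through \<open>s\<close>) and shrunk at the same time. The size
  of the smaller blocks is left open and is imposed separately.\<close>

definition subspread :: "(nat \<Rightarrow> 'a set) \<Rightarrow> (nat \<Rightarrow> 'a set) \<Rightarrow> bool" where
  "subspread E' E \<longleftrightarrow> (\<exists>s. strict_mono s \<and> (\<forall>n. E' n \<subseteq> E (s n)))"

lemma subspread_trans:
  assumes "subspread E'' E'" "subspread E' E"
  shows "subspread E'' E"
proof -
  obtain s t where "strict_mono s" "\<forall>n. E'' n \<subseteq> E' (s n)" "strict_mono t" "\<forall>n. E' n \<subseteq> E (t n)"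
    using assms unfolding subspread_def by blast
  then show ?thesis
    unfolding subspread_def by (intro exI[of _ "t \<circ> s"]) (auto simp: strict_mono_o)
qed

lemma subspread_refl: "subspread E E"
  unfolding subspread_def by (intro exI[of _ id]) (auto simp: strict_mono_def)

lemma spread_subspread:
  assumes "spread \<Omega> E" "subspread E' E" "\<And>n. n < card (E' n)"
  shows "spread \<Omega> E'"
proof -
  obtain s where s: "strict_mono s" "\<And>n. E' n \<subseteq> E (s n)"
    using assms(2) unfolding subspread_def by blast
  show ?thesis
  proof (rule spreadI)
    fix m n :: nat assume "m < n"
    then have "s m \<noteq> s n" using s(1) by (metis less_irrefl strict_mono_less)
    then have "E (s m) \<inter> E (s n) = {}"
      using assms(1) by (auto simp: spread_def disjoint_family_on_def)
    then show "E' m \<inter> E' n = {}" using s(2)[of m] s(2)[of n] by blast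
  next
    fix n
    show "finite (E' n)" "E' n \<subseteq> \<Omega>"
      using s(2)[of n] assms(1) finite_subset unfolding spread_def by blast+
  qed (rule assms(3))
qed

section \<open>Sequences of separated members obtained from indecisiveness\<close>

text \<open>The subspread \<open>E'\<close> is quantified inside and may change with
  \<open>N\<close>; only the members \<open>y i\<close> persist. The large remainder outside all
  \<open>y i\<close> leaves room for the next member.\<close>

definition separated :: "'a set set \<Rightarrow> (nat \<Rightarrow> 'a set) \<Rightarrow> (nat \<Rightarrow> 'a set) \<Rightarrow> nat \<Rightarrow> bool" where
  "separated S E y N \<longleftrightarrow> (\<exists>E'. subspread E' E \<and> (\<forall>i<N. y i \<in> S) \<and>
     (\<forall>n. n < card (E' n - (\<Union>i<N. y i))) \<and>
     (\<forall>n. \<forall>i<N. n < card (y i \<inter> E' n)) \<and>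
     (\<forall>n. \<forall>i<N. \<forall>j<N. i \<noteq> j \<longrightarrow> y i \<inter> y j \<inter> E' n = {}))"

lemma separated_extend:
  assumes sp: "spread \<Omega> E"
    and nd: "\<And>E' \<C>. subspread E' E \<Longrightarrow> spread \<Omega> E' \<Longrightarrow> colouring \<Omega> E' \<C> \<Longrightarrow> \<not> decisive \<Omega> S E' \<C>"
    and sep: "separated S E y N"
  shows "\<exists>z. separated S E (y(N := z)) (Suc N)"
proof -
  obtain E' where ref: "subspread E' E" and yS: "\<And>i. i < N \<Longrightarrow> y i \<in> S"
    and out: "\<And>n. n < card (E' n - (\<Union>i<N. y i))"
    and ins: "\<And>n i. i < N \<Longrightarrow> n < card (y i \<inter> E' n)"
    and dis: "\<And>n i j. i < N \<Longrightarrow> j < N \<Longrightarrow> i \<noteq> j \<Longrightarrow> y i \<inter> y j \<inter> E' n = {}"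
    using sep unfolding separated_def by metis
  define Y where "Y = (\<Union>i<N. y i)"
  obtain t where "\<And>n. E' n \<subseteq> E (t n)" using ref unfolding subspread_def by blast
  then have fin: "finite (E' n)" for n
    using sp finite_subset unfolding spread_def by metis
  have "n < card (E' n)" for n
    using out[of n] card_mono[OF fin[of n], of "E' n - (\<Union>i<N. y i)"] by fastforce
  then have sp': "spread \<Omega> E'" using spread_subspread[OF sp ref] by blast
  then have E'sub: "E' n \<subseteq> \<Omega>" for n by (auto simp: spread_def)
  define J where "J = spread_join E'"
  have EJ: "E' n \<subseteq> J" for n by (auto simp: J_def spread_join_def)
  have JO: "J \<subseteq> \<Omega>" using E'sub by (auto simp: J_def spread_join_def)
  \<comment> \<open>The cells must partition all of \<open>\<Omega>\<close>, so \<open>C0\<close>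
    also takes every point outside the join \<open>J\<close>. The \<open>y i\<close> are cut down to
    \<open>J\<close> because they may overlap elsewhere.\<close>
  define C0 where "C0 = \<Omega> - Y \<inter> J"
  define \<C> where "\<C> = insert C0 ((\<lambda>i. y i \<inter> J) ` {..<N})"
  have C0E: "C0 \<inter> E' n = E' n - Y" for n
    using EJ[of n] E'sub[of n] by (auto simp: C0_def)
  have yE: "y i \<inter> J \<inter> E' n = y i \<inter> E' n" for i n
    using EJ[of n] by auto
  have cellcard: "n < card (C \<inter> E' n)" if "C \<in> \<C>" for C n
    using that out[of n] ins[of _ n] by (auto simp: \<C>_def C0E yE Y_def)
  have ydis: "y i \<inter> J \<inter> (y j \<inter> J) = {}" if "i < N" "j < N" "i \<noteq> j" for i j
    using dis[OF that] by (auto simp: J_def spread_join_def)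
  have "colouring \<Omega> E' \<C>"
    unfolding colouring_def
  proof (intro conjI ballI)
    show "finite \<C>" by (simp add: \<C>_def)
    show "partition_on \<Omega> \<C>"
    proof (rule partition_onI)
      show "\<Union>\<C> = \<Omega>" using JO by (auto simp: \<C>_def C0_def Y_def)
    next
      show "{} \<notin> \<C>" using cellcard[of "{}" 0] by auto
    next
      fix p q assume pq: "p \<in> \<C>" "q \<in> \<C>" "p \<noteq> q"
      have "C0 \<inter> (y i \<inter> J) = {}" if "i < N" for i
        using that by (auto simp: C0_def Y_def)
      with pq ydis show "disjnt p q"
        unfolding \<C>_def disjnt_def by (auto simp del: Int_iff)
    qed
    fix C assume "C \<in> \<C>"
    then show "filterlim (\<lambda>n. card (C \<inter> E' n)) at_top sequentially"
      using cellcard by (intro filterlim_at_top_mono[OF filterlim_ident]) (simp add: less_imp_le)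
  qed
  then have "\<not> decisive \<Omega> S E' \<C>" using nd ref sp' by blast
  define M where "M x n = {card (x \<inter> C0 \<inter> E' n)} \<union> {card ((\<Omega> - x) \<inter> C \<inter> E' n) | C. C \<in> \<C>}" for x n
  have "C0 \<in> \<C>" by (simp add: \<C>_def)
  have "decisive \<Omega> S E' \<C> \<longleftrightarrow> (\<exists>C0\<in>\<C>. \<forall>x\<in>S.
      (SUP n. enat (Min ({card (x \<inter> C0 \<inter> E' n)} \<union> {card ((\<Omega> - x) \<inter> C \<inter> E' n) | C. C \<in> \<C>}))) \<noteq> \<infinity>)"
    by (simp add: decisive_def)
  \<comment> \<open>Indecisiveness refutes every choice of distinguished colour; it is used for the
    remainder \<open>C0\<close>.\<close>
  with \<open>\<not> decisive \<Omega> S E' \<C>\<close> \<open>C0 \<in> \<C>\<close>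
  obtain z where z: "z \<in> S" "(SUP n. enat (Min (M z n))) = \<infinity>"
    unfolding M_def by blast
  obtain s where s: "strict_mono s" "\<And>n. n < Min (M z (s n))"
    using unbounded_subsequence[OF z(2)] by blast
  have finM: "finite (M z n)" for n
    unfolding M_def \<C>_def by simp
  have lt: "n < k" if "k \<in> M z (s n)" for n k
    using s(2)[of n] Min_le[OF finM that] by linarith
  \<comment> \<open>Deleting \<open>z \<inter> Y\<close> makes \<open>z\<close> disjoint from the
    earlier members on the blocks. The points of \<open>z\<close> in \<open>C0\<close> and the
    points outside \<open>z\<close> in every cell survive, and the choice of \<open>s\<close> makes
    each of these sets large.\<close>
  define E'' where "E'' n = E' (s n) - z \<inter> Y" for n
  have fin'': "finite (E'' n)" for n using fin by (simp add: E''_def)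
  have z_out: "n < card (z \<inter> E'' n)" for n
  proof -
    have "n < card (z \<inter> C0 \<inter> E' (s n))" by (rule lt) (simp add: M_def)
    also have "\<dots> \<le> card (z \<inter> E'' n)"
      using fin'' C0E[of "s n"] by (intro card_mono) (auto simp: E''_def)
    finally show ?thesis .
  qed
  have new_out: "n < card (E'' n - (Y \<union> z))" for n
  proof -
    have "n < card ((\<Omega> - z) \<inter> C0 \<inter> E' (s n))" by (rule lt) (use \<open>C0 \<in> \<C>\<close> in \<open>auto simp: M_def\<close>)
    also have "\<dots> \<le> card (E'' n - (Y \<union> z))"
      using fin'' C0E[of "s n"] by (intro card_mono) (auto simp: E''_def)
    finally show ?thesis .
  qed
  have new_ins: "n < card (y i \<inter> E'' n)" if "i < N" for n i
  proof -
    have "y i \<inter> J \<in> \<C>" using that by (simp add: \<C>_def)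
    then have "n < card ((\<Omega> - z) \<inter> (y i \<inter> J) \<inter> E' (s n))"
      by (intro lt) (auto simp: M_def)
    also have "\<dots> \<le> card (y i \<inter> E'' n)"
      using fin'' by (intro card_mono) (auto simp: E''_def)
    finally show ?thesis .
  qed
  have ref'': "subspread E'' E"
    using s(1) by (intro subspread_trans[OF _ ref]) (auto simp: subspread_def E''_def)
  let ?y = "y(N := z)"
  have U: "(\<Union>i<Suc N. ?y i) = Y \<union> z"
    by (auto simp: Y_def lessThan_Suc)
  have zy: "z \<inter> y i \<inter> E'' n = {}" if "i < N" for i n
    using that by (auto simp: E''_def Y_def)
  have "separated S E ?y (Suc N)"
    unfolding separated_def U
  proof (intro exI conjI allI impI)
    fix n i j assume "i < Suc N" "j < Suc N" "i \<noteq> j"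
    moreover have "y i \<inter> y j \<inter> E'' n = {}" if "i < N" "j < N" "i \<noteq> j"
      using dis[OF that, of "s n"] by (auto simp: E''_def)
    ultimately show "?y i \<inter> ?y j \<inter> E'' n = {}"
      using zy[of i n] zy[of j n] by (auto simp: less_Suc_eq)
  qed (use ref'' yS z(1) z_out new_out new_ins in \<open>auto simp: less_Suc_eq\<close>)
  then show ?thesis by blast
qed

text \<open>Step \<open>n\<close> changes only coordinate \<open>n\<close>, and
  \<open>separated\<close> looks only at coordinates below \<open>N\<close>; hence the diagonal
  sequence inherits every stage.\<close>

lemma separated_sequence:
  assumes "spread \<Omega> E" "\<And>n. n < card (E n)"
    and "\<And>E' \<C>. subspread E' E \<Longrightarrow> spread \<Omega> E' \<Longrightarrow> colouring \<Omega> E' \<C> \<Longrightarrow> \<not> decisive \<Omega> S E' \<C>"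
  shows "\<exists>y. \<forall>N. separated S E y N"
proof -
  have cong: "separated S E y N = separated S E y' N" if "\<And>i. i < N \<Longrightarrow> y i = y' i" for y y' N
    using that unfolding separated_def by simp
  have "\<exists>f. \<forall>n. separated S E (f n) n \<and> f (Suc n) = (f n)(n := f (Suc n) n)"
  proof (rule dependent_nat_choice)
    show "\<exists>y. separated S E y 0"
      unfolding separated_def using assms(2) subspread_refl by auto
  next
    fix y n assume "separated S E y n"
    then obtain z where "separated S E (y(n := z)) (Suc n)"
      using separated_extend[OF assms(1,3)] by blast
    then show "\<exists>y'. separated S E y' (Suc n) \<and> y' = y(n := y' n)"
      by (intro exI[of _ "y(n := z)"]) simp
  qed
  then obtain f where f: "\<And>n. separated S E (f n) n" "\<And>n. f (Suc n) = (f n)(n := f (Suc n) n)"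
    by blast
  define y where "y i = f (Suc i) i" for i
  have "f n i = y i" if "i < n" for n i
    using that
  proof (induction n)
    case (Suc n)
    then show ?case
      by (subst f(2)) (auto simp: y_def less_Suc_eq)
  qed simp
  then have "separated S E y N" for N
    using f(1)[of N] cong[of N "f N" y] by auto
  then show ?thesis by blast
qed

text \<open>A point private to \<open>y i\<close> among the first \<open>N\<close> members is
  available for every \<open>N\<close>. Choosing \<open>N\<close> anew for each block makes the
  members of earlier blocks miss it.\<close>

lemma T_max_of_separated_sequence:
  assumes uc: "union_closed_on \<Omega> S" and sep: "\<And>N. separated S E y N"
  shows "\<exists>E. spread \<Omega> E \<and> T_max E \<subseteq> traces S (spread_join E)"
proof -
  have yS: "y i \<in> S" for i
    using sep[of "Suc i"] unfolding separated_def by blast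
  have "\<exists>g. \<forall>i<N. g i \<in> y i \<and> (\<forall>j<N. j \<noteq> i \<longrightarrow> g i \<notin> y j)" for N
  proof -
    obtain E' where ins: "\<And>n i. i < N \<Longrightarrow> n < card (y i \<inter> E' n)"
      and dis: "\<And>n i j. i < N \<Longrightarrow> j < N \<Longrightarrow> i \<noteq> j \<Longrightarrow> y i \<inter> y j \<inter> E' n = {}"
      using sep[of N] unfolding separated_def by metis
    have "\<exists>\<gamma>. \<gamma> \<in> y i \<and> (\<forall>j<N. j \<noteq> i \<longrightarrow> \<gamma> \<notin> y j)" if "i < N" for i
    proof -
      have "y i \<inter> E' 0 \<noteq> {}" using ins[OF that, of 0] by auto
      then show ?thesis using dis[OF that, of _ 0] by blast
    qed
    then show ?thesis by metis
  qed
  then obtain g where g: "\<And>N i. i < N \<Longrightarrow> g N i \<in> y i"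
      "\<And>N i j. i < N \<Longrightarrow> j < N \<Longrightarrow> j \<noteq> i \<Longrightarrow> g N i \<notin> y j"
    by metis
  \<comment> \<open>Block \<open>n\<close> uses the \<open>2 * n + 1\<close> indices from
    \<open>n * n\<close> up to but excluding \<open>Suc n * Suc n\<close>. Its points are private
    among all members below the upper end, hence avoid every \<open>y i\<close> with
    \<open>i < n * n\<close>.\<close>
  define D where "D n = g (Suc n * Suc n) ` {n * n..<Suc n * Suc n}" for n
  have "inj_on (g N) {..<N}" for N
    using g by (metis inj_onI lessThan_iff)
  then have "inj_on (g (Suc n * Suc n)) {n * n..<Suc n * Suc n}" for n
    by (rule inj_on_subset) auto
  then have cardD: "n < card (D n)" for n
    unfolding D_def by (simp add: card_image)
  have trace_later: "y i \<inter> D n = {}" if "i < n * n" for i n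
    using that g(2)[of _ "Suc n * Suc n" i] unfolding D_def by fastforce
  \<comment> \<open>Members indexed in block \<open>m\<close> therefore fall under
    \<open>trace_later\<close> for every later block \<open>n\<close>.\<close>
  have le: "Suc m * Suc m \<le> n * n" if "m < n" for m n :: nat
    using that by (intro mult_le_mono) auto
  have index: "\<exists>i. i < Suc n * Suc n \<and> \<gamma> \<in> y i \<and> y i \<inter> D n = {\<gamma>}" if "\<gamma> \<in> D n" for n \<gamma>
  proof -
    obtain i where i: "n * n \<le> i" "i < Suc n * Suc n" "\<gamma> = g (Suc n * Suc n) i"
      using \<open>\<gamma> \<in> D n\<close> unfolding D_def by auto
    have "\<delta> = \<gamma>" if \<delta>: "\<delta> \<in> y i" "\<delta> \<in> D n" for \<delta>
    proof -
      obtain j where "j < Suc n * Suc n" "\<delta> = g (Suc n * Suc n) j"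
        using \<delta>(2) unfolding D_def by auto
      then show ?thesis using g(2)[of j _ i] i \<delta>(1) by blast
    qed
    moreover have "\<gamma> \<in> y i" using g(1) i by blast
    ultimately have "y i \<inter> D n = {\<gamma>}" using \<open>\<gamma> \<in> D n\<close> by blast
    with i show ?thesis by blast
  qed
  have "spread \<Omega> D"
  proof (rule spreadI)
    fix n
    show "finite (D n)" by (simp add: D_def)
    show "D n \<subseteq> \<Omega>"
      using index[of _ n] yS uc unfolding union_closed_on_def by blast
  next
    fix m n :: nat assume "m < n"
    then show "D m \<inter> D n = {}"
      using index[of _ m] trace_later[of _ n] le[of m n]
      by (meson disjoint_iff order_less_le_trans)
  qed (rule cardD)
  moreover have "T_max D \<subseteq> traces S (spread_join D)"
  proof (rule T_max_subset_traces[OF uc])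
    fix n \<gamma> assume "\<gamma> \<in> D n"
    then obtain i where "i < Suc n * Suc n" "y i \<inter> D n = {\<gamma>}" using index by blast
    then show "\<exists>x\<in>S. x \<inter> D n = {\<gamma>} \<and> (\<forall>m>n. x \<inter> D m = {})"
      using yS trace_later le by (meson order_less_le_trans)
  qed (simp add: D_def)
  ultimately show ?thesis by blast
qed

section \<open>Case analysis on the homogeneous blocks\<close>

lemma free_inj_on_fst: "free F \<Longrightarrow> inj_on fst F"
  unfolding free_def inj_on_def by metis

theorem theorem4p6:
  fixes \<Omega> :: "'a set" and S :: "'a set set"
  assumes "\<Omega> \<noteq> {}"
    and "union_closed_on \<Omega> S"
    and "breadth S = \<infinity>"
  shows "\<exists>E. spread \<Omega> E \<and>
    (T_max E \<subseteq> {x \<inter> spread_join E | x. x \<in> S} \<or>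
     T_min E \<subseteq> {x \<inter> spread_join E | x. x \<in> S} \<or>
     (T_ort E \<subseteq> {x \<inter> spread_join E | x. x \<in> S} \<and>
      (\<exists>\<C>. colouring \<Omega> E \<C> \<and> decisive \<Omega> S E \<C>)))"
proof -
  note uc = assms(2)
  have SO: "S \<subseteq> Pow \<Omega>" using uc by (simp add: union_closed_on_def)
  obtain F e e' where seq:
    "\<forall>n. F n \<subseteq> {p. fst p \<in> \<Omega> \<and> snd p \<in> S} \<and> finite (F n) \<and> n + 2 \<le> card (F n) \<and> free (F n)"
    "\<forall>m n. m < n \<longrightarrow> (\<forall>p\<in>F m. \<forall>q\<in>F n. (fst q \<in> snd p \<longleftrightarrow> e) \<and> (fst p \<in> snd q \<longleftrightarrow> e'))"
    using big_homogeneous_sequence[OF big_of_infinite_breadth[OF SO assms(3)]] by blast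
  then have F: "\<And>n. F n \<subseteq> {p. fst p \<in> \<Omega> \<and> snd p \<in> S}" "\<And>n. finite (F n)" "\<And>n. n + 2 \<le> card (F n)" "\<And>n. free (F n)"
    and later: "\<And>m n p q. m < n \<Longrightarrow> p \<in> F m \<Longrightarrow> q \<in> F n \<Longrightarrow> fst q \<in> snd p \<longleftrightarrow> e"
    and earlier: "\<And>m n p q. m < n \<Longrightarrow> p \<in> F m \<Longrightarrow> q \<in> F n \<Longrightarrow> fst p \<in> snd q \<longleftrightarrow> e'"
    by blast+
  define E where "E n = fst ` F n" for n
  have fin: "finite (E n)" for n using F(2) by (simp add: E_def)
  have cardE: "n < card (E n)" for n
    using F(3)[of n] free_inj_on_fst[OF F(4)] by (simp add: E_def card_image)
  have diag: "snd p \<inter> E n = {fst p}" if "p \<in> F n" for p n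
    using that F(4)[of n] unfolding free_def E_def by auto
  have "spread \<Omega> E"
  proof (rule spreadI)
    fix m n :: nat assume "m < n"
    show "E m \<inter> E n = {}"
    proof (rule ccontr)
      assume "E m \<inter> E n \<noteq> {}"
      then obtain p q where pq: "p \<in> F m" "q \<in> F n" "fst p = fst q"
        unfolding E_def by auto
      \<comment> \<open>A common point lies in \<open>snd p\<close>, so \<open>e\<close> holds; then
        it also lies in \<open>snd r\<close> for a second pair \<open>r\<close> of the same block,
        against freeness.\<close>
      have "F m \<noteq> {p}" using F(3)[of m] by auto
      then obtain r where "r \<in> F m" "r \<noteq> p" using pq(1) by blast
      then show False
        using later[OF \<open>m < n\<close> _ pq(2)] pq F(4)[of m] unfolding free_def by metis
    qed
  qed (use fin cardE F(1) in \<open>auto simp: E_def\<close>)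
  consider (max) "\<not> e" | (min) "e" "\<not> e'" | (ort) "e" "e'" by blast
  then have "\<exists>E. spread \<Omega> E \<and> (T_max E \<subseteq> traces S (spread_join E) \<or> T_min E \<subseteq> traces S (spread_join E) \<or>
     (T_ort E \<subseteq> traces S (spread_join E) \<and> (\<exists>\<C>. colouring \<Omega> E \<C> \<and> decisive \<Omega> S E \<C>)))"
  proof cases
    case max
    have "T_max E \<subseteq> traces S (spread_join E)"
    proof (rule T_max_subset_traces[OF uc fin])
      fix n \<gamma> assume "\<gamma> \<in> E n"
      then obtain p where p: "p \<in> F n" "\<gamma> = fst p" by (auto simp: E_def)
      then show "\<exists>x\<in>S. x \<inter> E n = {\<gamma>} \<and> (\<forall>m>n. x \<inter> E m = {})"
        using F(1)[of n] diag[of p n] later[of n _ p] max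
        by (intro bexI[of _ "snd p"]) (auto simp: E_def)
    qed
    then show ?thesis using \<open>spread \<Omega> E\<close> by blast
  next
    case min
    have "T_min E \<subseteq> traces S (spread_join E)"
    proof (rule T_min_subset_traces[OF uc fin])
      fix n \<gamma> assume "\<gamma> \<in> E n"
      then obtain p where p: "p \<in> F n" "\<gamma> = fst p" by (auto simp: E_def)
      then show "\<exists>x\<in>S. x \<inter> E n = {\<gamma>} \<and> (\<forall>m>n. E m \<subseteq> x) \<and> (\<forall>m<n. x \<inter> E m = {})"
        using F(1)[of n] diag[of p n] later[of n _ p] earlier[of _ n _ p] min
        by (intro bexI[of _ "snd p"]) (auto simp: E_def)
    qed
    then show ?thesis using \<open>spread \<Omega> E\<close> by blast
  next
    case ort
    \<comment> \<open>Proved for \<open>E\<close> before the case split, because this property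
      passes to every subspread.\<close>
    have wit: "\<exists>x\<in>S. x \<inter> E n = {\<gamma>} \<and> (\<forall>m. m \<noteq> n \<longrightarrow> E m \<subseteq> x)" if \<gamma>: "\<gamma> \<in> E n" for n \<gamma>
    proof -
      obtain p where p: "p \<in> F n" "\<gamma> = fst p" using \<gamma> by (auto simp: E_def)
      then show ?thesis
        using F(1)[of n] diag[of p n] later[of n _ p] earlier[of _ n _ p] ort
        by (intro bexI[of _ "snd p"]) (auto simp: E_def neq_iff)
    qed
    show ?thesis
    \<comment> \<open>A decisive colouring is sought on any subspread, and the \<open>T_ort\<close>
      alternative is then realised on that subspread. If none has one, a spread unrelated to the
      blocks \<open>E n\<close> realises \<open>T_max\<close>.\<close>
    proof (cases "\<exists>E' \<C>. subspread E' E \<and> spread \<Omega> E' \<and> colouring \<Omega> E' \<C> \<and> decisive \<Omega> S E' \<C>")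
      case True
      then obtain E' \<C> s where E': "spread \<Omega> E'" "colouring \<Omega> E' \<C>" "decisive \<Omega> S E' \<C>"
        and s: "strict_mono s" "\<And>n. E' n \<subseteq> E (s n)"
        unfolding subspread_def by blast
      have "T_ort E' \<subseteq> traces S (spread_join E')"
      proof (rule T_ort_subset_traces[OF uc])
        show "finite (E' n)" for n using s(2) fin finite_subset by metis
        fix n \<gamma> assume \<gamma>: "\<gamma> \<in> E' n"
        then obtain x where x: "x \<in> S" "x \<inter> E (s n) = {\<gamma>}" "\<forall>m. m \<noteq> s n \<longrightarrow> E m \<subseteq> x"
          using wit[of \<gamma> "s n"] s(2) by blast
        have "E' m \<subseteq> x" if "m \<noteq> n" for m
        proof -
          \<comment> \<open>Different blocks of \<open>E'\<close> sit in different blocks of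
            \<open>E\<close>, so the witness for block \<open>s n\<close> contains all of
            \<open>E' m\<close>.\<close>
          have "s m \<noteq> s n" using s(1) that by (simp add: strict_mono_eq)
          then show ?thesis using x(3) s(2)[of m] by blast
        qed
        moreover have "x \<inter> E' n = {\<gamma>}" using x(2) \<gamma> s(2)[of n] by blast
        ultimately show "\<exists>x\<in>S. x \<inter> E' n = {\<gamma>} \<and> (\<forall>m. m \<noteq> n \<longrightarrow> E' m \<subseteq> x)"
          using x(1) by blast
      qed
      then show ?thesis using E' by blast
    next
      case False
      then obtain y where "\<And>N. separated S E y N"
        using separated_sequence[OF \<open>spread \<Omega> E\<close> cardE] by metis
      then show ?thesis using T_max_of_separated_sequence[OF uc] by metis
    qed
  qed
  then show ?thesis unfolding traces_def .
qed

end
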